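(* Let $R$ be an integral domain and let $(K,w)$ be a weighted simplicial complex with $K$ finite and $w:K\to R$. Let $n\ge 1$ and let $\sigma^{(n-1)}<\tau^{(n)}$ be simplices of $K$ such that $\sigma$ is a free face of $\tau$ in $K$, so that $K$ collapses onto $L=K\setminus\{\sigma,\tau\}$ by an elementary collapse of dimension $n$. Suppose that $w(\sigma)\in R\setminus\{0\}$ and $w(\tau)=u\,w(\sigma)$ for some unit $u\in R$. Then the collapse $K\searrow L$ preserves weighted homology, i.e. $H_i(K,w)\cong H_i(L,w)$ for all $i\ge 0$.
   Context: $R$ is an integral domain (commutative, with unity). Simplicial complexes are finite abstract simplicial complexes (simplices are nonempty finite sets of vertices); $\sigma^{(n)}$ indicates that $\dim\sigma=n$, and $\sigma<\tau$ means $\sigma\subsetneq\tau$. A weighted simplicial complex (WSC) is a pair $(K,w)$ of a simplicial complex $K$ and a function $w:K\to R$ such that $\sigma_1\subseteq\sigma_2$ implies $w(\sigma_1)\mid w(\sigma_2)$ in $R$. $C_n(K,w)$ is the free $R$-module with basis the $n$-simplices of $K$ with nonzero weight ($C_{-1}=0$). Fixing a total order on the vertices, the weighted boundary map $\partial_n^w:C_n(K,w)\to C_{n-1}(K,w)$ is the $R$-linear map with $\partial_n^w(\sigma)=\sum_{i=0}^n\frac{w(\sigma)}{w(d_i\sigma)}(-1)^i d_i\sigma$, where $d_i[v_0,\dots,v_n]=[v_0,\dots,\widehat{v_i},\dots,v_n]$. The weighted homology is the $R$-module $H_n(K,w)=\ker(\partial_n^w)/\operatorname{Im}(\partial_{n+1}^w)$.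 For a subcomplex $L\subseteq K$, $(L,w)$ means $(L,w|_L)$. If $\sigma<\tau$ and $\sigma$ is not a proper face of any simplex of $K$ other than $\tau$, then $\sigma$ is called a free face of $\tau$ (in $K$); then necessarily $\dim\tau=\dim\sigma+1$ and $\tau$ is a maximal simplex of $K$. In this situation, with $\dim \tau=n$, $K$ is said to collapse onto $L=K\setminus\{\sigma,\tau\}$ by an elementary collapse of dimension $n$. *)

theory Defs
  imports "HOL-Algebra.Module" "HOL-Algebra.AbelCoset" "HOL-Algebra.Divisibility"
begin

section \<open>Modules\<close>

text \<open>
  The fields \<open>mult\<close> and \<open>one\<close> of a \<open>module\<close> record are inherited from the ring
  record and have no meaning for a module; they are left unspecified.
\<close>

definition free_module :: "('r, 'm) ring_scheme \<Rightarrow> 'b set \<Rightarrow> ('r, 'b \<Rightarrow> 'r) module" where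
  "free_module R B =
     \<lparr>carrier = {c \<in> UNIV \<rightarrow> carrier R.
                  {b. c b \<noteq> \<zero>\<^bsub>R\<^esub>} \<subseteq> B \<and> finite {b. c b \<noteq> \<zero>\<^bsub>R\<^esub>}},
      monoid.mult = undefined,
      one = undefined,
      zero = (\<lambda>b. \<zero>\<^bsub>R\<^esub>),
      add = (\<lambda>c d b. c b \<oplus>\<^bsub>R\<^esub> d b),
      smult = (\<lambda>r c b. r \<otimes>\<^bsub>R\<^esub> c b)\<rparr>"

definition basis_elem :: "('r, 'm) ring_scheme \<Rightarrow> 'b \<Rightarrow> 'b \<Rightarrow> 'r" where
  "basis_elem R a = (\<lambda>b. if b = a then \<one>\<^bsub>R\<^esub> else \<zero>\<^bsub>R\<^esub>)"

definition quotient_module :: "('r, 'a) module \<Rightarrow> 'a set \<Rightarrow> ('r, 'a set) module" where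
  "quotient_module M N =
     \<lparr>carrier = a_rcosets\<^bsub>M\<^esub> N,
      monoid.mult = undefined,
      one = undefined,
      zero = N,
      add = (\<lambda>X Y. X <+>\<^bsub>M\<^esub> Y),
      smult = (\<lambda>r X. \<Union>x\<in>X. N +>\<^bsub>M\<^esub> (r \<odot>\<^bsub>M\<^esub> x))\<rparr>"

definition module_iso ::
  "('r, 'm) ring_scheme \<Rightarrow> ('r, 'a) module \<Rightarrow> ('r, 'b) module \<Rightarrow> ('a \<Rightarrow> 'b) set" where
  "module_iso R M N =
     {h. bij_betw h (carrier M) (carrier N)
       \<and> (\<forall>x\<in>carrier M. \<forall>y\<in>carrier M. h (x \<oplus>\<^bsub>M\<^esub> y) = h x \<oplus>\<^bsub>N\<^esub> h y)
       \<and> (\<forall>r\<in>carrier R. \<forall>x\<in>carrier M. h (r \<odot>\<^bsub>M\<^esub> x) = r \<odot>\<^bsub>N\<^esub> h x)}"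

definition module_isomorphic ::
  "('r, 'm) ring_scheme \<Rightarrow> ('r, 'a) module \<Rightarrow> ('r, 'b) module \<Rightarrow> bool" where
  "module_isomorphic R M N \<longleftrightarrow> module_iso R M N \<noteq> {}"


section \<open>Weighted simplicial complexes\<close>

definition simplicial_complex :: "'v set set \<Rightarrow> bool" where
  "simplicial_complex K \<longleftrightarrow>
     finite K \<and> (\<forall>\<sigma>\<in>K. finite \<sigma> \<and> \<sigma> \<noteq> {})
     \<and> (\<forall>\<sigma>\<in>K. \<forall>\<rho>. \<rho> \<subseteq> \<sigma> \<and> \<rho> \<noteq> {} \<longrightarrow> \<rho> \<in> K)"

text \<open>Only used for nonempty finite sets, so the truncated subtraction is harmless.\<close>

definition sdim :: "'v set \<Rightarrow> nat" where
  "sdim \<sigma> = card \<sigma> - 1"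

text \<open>
  A weight function is a total function on sets of vertices, of which only the values on
  \<open>K\<close> matter. In particular, the restriction of \<open>w\<close> to a subcomplex is again written \<open>w\<close>.
\<close>

definition weighted_complex ::
  "('r, 'm) ring_scheme \<Rightarrow> 'v set set \<Rightarrow> ('v set \<Rightarrow> 'r) \<Rightarrow> bool" where
  "weighted_complex R K w \<longleftrightarrow>
     simplicial_complex K \<and> w \<in> K \<rightarrow> carrier R
     \<and> (\<forall>\<sigma>\<^sub>1\<in>K. \<forall>\<sigma>\<^sub>2\<in>K. \<sigma>\<^sub>1 \<subseteq> \<sigma>\<^sub>2 \<longrightarrow> w \<sigma>\<^sub>1 divides\<^bsub>R\<^esub> w \<sigma>\<^sub>2)"

definition free_face :: "'v set set \<Rightarrow> 'v set \<Rightarrow> 'v set \<Rightarrow> bool" where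
  "free_face K \<sigma> \<tau> \<longleftrightarrow>
     \<sigma> \<in> K \<and> \<tau> \<in> K \<and> \<sigma> \<subset> \<tau> \<and> (\<forall>\<rho>\<in>K. \<sigma> \<subset> \<rho> \<longrightarrow> \<rho> = \<tau>)"

definition elementary_collapse ::
  "'v set set \<Rightarrow> 'v set \<Rightarrow> 'v set \<Rightarrow> nat \<Rightarrow> 'v set set \<Rightarrow> bool" where
  "elementary_collapse K \<sigma> \<tau> n L \<longleftrightarrow>
     free_face K \<sigma> \<tau> \<and> sdim \<tau> = n \<and> L = K - {\<sigma>, \<tau>}"


section \<open>Weighted homology\<close>

definition weighted_basis ::
  "('r, 'm) ring_scheme \<Rightarrow> 'v set set \<Rightarrow> ('v set \<Rightarrow> 'r) \<Rightarrow> nat \<Rightarrow> 'v set set" where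
  "weighted_basis R K w n = {\<sigma> \<in> K. sdim \<sigma> = n \<and> w \<sigma> \<noteq> \<zero>\<^bsub>R\<^esub>}"

definition weighted_chains ::
  "('r, 'm) ring_scheme \<Rightarrow> 'v set set \<Rightarrow> ('v set \<Rightarrow> 'r) \<Rightarrow> nat \<Rightarrow> ('r, 'v set \<Rightarrow> 'r) module" where
  "weighted_chains R K w n = free_module R (weighted_basis R K w n)"

text \<open>The face obtained by deleting the \<open>i\<close>-th vertex in increasing order, counted from 0.\<close>

definition dface :: "nat \<Rightarrow> 'v::linorder set \<Rightarrow> 'v set" where
  "dface i \<sigma> = \<sigma> - {sorted_list_of_set \<sigma> ! i}"

text \<open>
  The quotient \<open>a / b\<close> in an integral domain, for \<open>b \<noteq> 0\<close> dividing \<open>a\<close>. If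
  \<open>w \<sigma> \<noteq> 0\<close>, the weights of all faces of \<open>\<sigma>\<close> are nonzero, too, because they divide \<open>w \<sigma>\<close>.
\<close>

definition quot :: "('r, 'm) ring_scheme \<Rightarrow> 'r \<Rightarrow> 'r \<Rightarrow> 'r" where
  "quot R a b = (THE q. q \<in> carrier R \<and> a = b \<otimes>\<^bsub>R\<^esub> q)"

text \<open>The boundary of an \<open>n + 1\<close>-simplex, as an \<open>n\<close>-chain.\<close>

definition simplex_boundary ::
  "('r, 'm) ring_scheme \<Rightarrow> 'v::linorder set set \<Rightarrow> ('v set \<Rightarrow> 'r) \<Rightarrow> nat \<Rightarrow> 'v set \<Rightarrow> 'v set \<Rightarrow> 'r" where
  "simplex_boundary R K w n \<sigma> =
     (\<Oplus>\<^bsub>weighted_chains R K w n\<^esub> i \<in> {..Suc n}.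
        (quot R (w \<sigma>) (w (dface i \<sigma>)) \<otimes>\<^bsub>R\<^esub> (\<ominus>\<^bsub>R\<^esub> \<one>\<^bsub>R\<^esub>) [^]\<^bsub>R\<^esub> i)
          \<odot>\<^bsub>weighted_chains R K w n\<^esub> basis_elem R (dface i \<sigma>))"

text \<open>
  The linear extension to chains. The chain module in degree \<open>-1\<close> is zero, so the boundary
  map in degree 0 is the zero map.
\<close>

fun weighted_boundary ::
  "('r, 'm) ring_scheme \<Rightarrow> 'v::linorder set set \<Rightarrow> ('v set \<Rightarrow> 'r) \<Rightarrow> nat
    \<Rightarrow> ('v set \<Rightarrow> 'r) \<Rightarrow> ('v set \<Rightarrow> 'r)" where
  "weighted_boundary R K w 0 c = (\<lambda>_. \<zero>\<^bsub>R\<^esub>)"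
| "weighted_boundary R K w (Suc n) c =
     (\<Oplus>\<^bsub>weighted_chains R K w n\<^esub> \<sigma> \<in> weighted_basis R K w (Suc n).
        c \<sigma> \<odot>\<^bsub>weighted_chains R K w n\<^esub> simplex_boundary R K w n \<sigma>)"

definition weighted_cycles ::
  "('r, 'm) ring_scheme \<Rightarrow> 'v::linorder set set \<Rightarrow> ('v set \<Rightarrow> 'r) \<Rightarrow> nat \<Rightarrow> ('v set \<Rightarrow> 'r) set" where
  "weighted_cycles R K w n =
     {c \<in> carrier (weighted_chains R K w n). weighted_boundary R K w n c = (\<lambda>_. \<zero>\<^bsub>R\<^esub>)}"

definition weighted_boundaries ::
  "('r, 'm) ring_scheme \<Rightarrow> 'v::linorder set set \<Rightarrow> ('v set \<Rightarrow> 'r) \<Rightarrow> nat \<Rightarrow> ('v set \<Rightarrow> 'r) set" where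
  "weighted_boundaries R K w n =
     weighted_boundary R K w (Suc n) ` carrier (weighted_chains R K w (Suc n))"

definition weighted_homology ::
  "('r, 'm) ring_scheme \<Rightarrow> 'v::linorder set set \<Rightarrow> ('v set \<Rightarrow> 'r) \<Rightarrow> nat
    \<Rightarrow> ('r, ('v set \<Rightarrow> 'r) set) module" where
  "weighted_homology R K w n =
     quotient_module ((weighted_chains R K w n)\<lparr>carrier := weighted_cycles R K w n\<rparr>)
       (weighted_boundaries R K w n)"

end

theory Submission
  imports Defs
begin

text \<open>
  Since \<open>w \<tau> = u w \<sigma>\<close>, the coefficient of \<open>\<sigma>\<close> in \<open>\<partial>\<tau>\<close> is the unit \<open>\<plusminus>u\<close>, and since \<open>\<sigma>\<close> is free, \<open>\<tau>\<close> is the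
  only simplex whose boundary involves \<open>\<sigma>\<close>. Hence adding a multiple of the boundary \<open>\<partial>\<tau>\<close> removes
  \<open>\<sigma>\<close> from a chain without changing the boundary of the chain, and a chain containing \<open>\<tau>\<close> has a
  boundary containing \<open>\<sigma>\<close>. It follows that in each degree
  \<open>Z(K) = Z(L) + B(K)\<close> and \<open>Z(L) \<inter> B(K) = B(L)\<close>, so that \<open>Z(K) / B(K)\<close> and \<open>Z(L) / B(L)\<close> are isomorphic.
\<close>

section \<open>Modules\<close>

text \<open>Negation is scalar multiplication by \<open>\<ominus> \<one>\<close>, so closure under
  negatives follows from closure under scalars.\<close>

lemma (in module) submoduleI':
  assumes "H \<subseteq> carrier M" and "\<zero>\<^bsub>M\<^esub> \<in> H"
    and "\<And>x y. x \<in> H \<Longrightarrow> y \<in> H \<Longrightarrow> x \<oplus>\<^bsub>M\<^esub> y \<in> H"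
    and smult: "\<And>a x. a \<in> carrier R \<Longrightarrow> x \<in> H \<Longrightarrow> a \<odot>\<^bsub>M\<^esub> x \<in> H"
  shows "submodule H R M"
proof (rule submoduleI)
  fix x assume "x \<in> H"
  then show "\<ominus>\<^bsub>M\<^esub> x \<in> H"
    using smult[of "\<ominus> \<one>" x] assms(1) by (auto simp: smult_l_minus)
qed (use assms in auto)

text \<open>A form of the second isomorphism theorem. By \<open>decomp\<close>, every coset of
  \<open>B\<close> in \<open>Z\<close> has a representative in \<open>Z'\<close>; by
  \<open>inter\<close>, two such representatives differ by an element of \<open>B'\<close>. All four
  sets are submodules of one ambient module \<open>M\<close>, so that their cosets can be
  compared.\<close>

lemma quotient_module_isomorphicI:
  fixes R :: "('r, 'm) ring_scheme" and M :: "('r, 'a) module"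
  assumes "module R M"
    and Z: "submodule Z R M" and Z': "submodule Z' R M"
    and B: "submodule B R M" and B': "submodule B' R M"
    and "Z' \<subseteq> Z" and "B' \<subseteq> B"
    and decomp: "\<And>z. z \<in> Z \<Longrightarrow> \<exists>b\<in>B. b \<oplus>\<^bsub>M\<^esub> z \<in> Z'"
    and inter: "Z' \<inter> B \<subseteq> B'"
  shows "module_isomorphic R (quotient_module (M\<lparr>carrier := Z\<rparr>) B)
           (quotient_module (M\<lparr>carrier := Z'\<rparr>) B')"
proof -
  interpret module R M by fact
  interpret B: abelian_subgroup B M
    by (intro abelian_subgroupI3 additive_subgroup.intro is_abelian_group
        M.abelian_group_axioms submodule.axioms(1)[OF B])
  interpret B': abelian_subgroup B' M
    by (intro abelian_subgroupI3 additive_subgroup.intro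
        M.abelian_group_axioms submodule.axioms(1)[OF B'])
  have carr: "z \<in> carrier M" if "z \<in> Z" for z
    using that submoduleE(1)[OF Z] by auto
  have carr': "z \<in> carrier M" if "z \<in> Z'" for z
    using that submoduleE(1)[OF Z'] by auto
  \<comment> \<open>Cosets and their sums involve only the addition of the module, so overwriting
    the carrier does not affect them.\<close>
  have coset_update: "H +>\<^bsub>M\<lparr>carrier := C\<rparr>\<^esub> x = H +>\<^bsub>M\<^esub> x" for H C x
    by (simp add: a_r_coset_def')
  have sum_update: "X <+>\<^bsub>M\<lparr>carrier := C\<rparr>\<^esub> Y = X <+>\<^bsub>M\<^esub> Y" for X Y C
    by (simp add: set_add_def')
  \<comment> \<open>\<open>quotient_module\<close> defines a scalar multiple as a union over all
    representatives. The cosets in this union coincide, so it is a single coset.\<close>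
  have smult_coset: "(\<Union>y\<in>H +>\<^bsub>M\<^esub> x. H +>\<^bsub>M\<^esub> (r \<odot>\<^bsub>M\<^esub> y)) = H +>\<^bsub>M\<^esub> (r \<odot>\<^bsub>M\<^esub> x)"
    if H: "submodule H R M" and x: "x \<in> carrier M" and r: "r \<in> carrier R" for H x r
  proof -
    interpret H: abelian_subgroup H M
      by (intro abelian_subgroupI3 additive_subgroup.intro
          M.abelian_group_axioms submodule.axioms(1)[OF H])
    have "H +>\<^bsub>M\<^esub> (r \<odot>\<^bsub>M\<^esub> y) = H +>\<^bsub>M\<^esub> (r \<odot>\<^bsub>M\<^esub> x)" if "y \<in> H +>\<^bsub>M\<^esub> x" for y
    proof -
      from that obtain h where h: "h \<in> H" "y = h \<oplus>\<^bsub>M\<^esub> x"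
        by (auto simp: a_r_coset_def')
      then have "r \<odot>\<^bsub>M\<^esub> y = r \<odot>\<^bsub>M\<^esub> h \<oplus>\<^bsub>M\<^esub> r \<odot>\<^bsub>M\<^esub> x"
        using r x H.a_Hcarr by (simp add: smult_r_distr)
      moreover have "r \<odot>\<^bsub>M\<^esub> h \<in> H"
        using submoduleE(4)[OF H] r h by blast
      ultimately show ?thesis
        using H.a_repr_independence' r x M.a_rcosI[OF _ H.a_subset] by (metis smult_closed)
    qed
    then show ?thesis
      using H.a_rcos_self[OF x] by blast
  qed
  \<comment> \<open>The representatives of \<open>X\<close> in \<open>Z'\<close> all lie in one
    coset of \<open>B'\<close>. Taking the union selects that coset without choosing a
    representative.\<close>
  define h where "h X = (\<Union>x\<in>X \<inter> Z'. B' +>\<^bsub>M\<^esub> x)" for X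
  have h: "h (B +>\<^bsub>M\<^esub> z) = B' +>\<^bsub>M\<^esub> z" if z: "z \<in> Z'" for z
  proof -
    have "B' +>\<^bsub>M\<^esub> x = B' +>\<^bsub>M\<^esub> z" if x: "x \<in> B +>\<^bsub>M\<^esub> z" "x \<in> Z'" for x
    proof -
      have "x \<ominus>\<^bsub>M\<^esub> z \<in> B"
        using B.a_rcos_module_imp[OF carr'[OF z] x(1)] by (simp add: M.minus_eq)
      moreover have "x \<ominus>\<^bsub>M\<^esub> z \<in> Z'"
        using submoduleE[OF Z'] x z by (simp add: M.minus_eq)
      ultimately have "x \<oplus>\<^bsub>M\<^esub> \<ominus>\<^bsub>M\<^esub> z \<in> B'"
        using inter by (auto simp: M.minus_eq)
      then show ?thesis
        using B'.a_rcos_module_rev B'.a_repr_independence' carr' x z by metis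
    qed
    then show ?thesis
      unfolding h_def using B.a_rcos_self[OF carr'[OF z]] z by blast
  qed
  have rep: "\<exists>z'\<in>Z'. B +>\<^bsub>M\<^esub> z = B +>\<^bsub>M\<^esub> z'" if "z \<in> Z" for z
    using decomp[OF that] B.a_repr_independence' M.a_rcosI[OF _ B.a_subset] carr[OF that] by metis
  \<comment> \<open>Every coset in the domain is now represented in \<open>Z'\<close>, where the
    preceding fact \<open>h\<close> evaluates the map.\<close>
  have dom: "carrier (quotient_module (M\<lparr>carrier := Z\<rparr>) B) = (\<lambda>z. B +>\<^bsub>M\<^esub> z) ` Z'"
    using rep \<open>Z' \<subseteq> Z\<close> by (fastforce simp: quotient_module_def A_RCOSETS_def' coset_update)
  have ran: "carrier (quotient_module (M\<lparr>carrier := Z'\<rparr>) B') = (\<lambda>z. B' +>\<^bsub>M\<^esub> z) ` Z'"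
    by (auto simp: quotient_module_def A_RCOSETS_def' coset_update)
  \<comment> \<open>Injectivity rests on \<open>B' \<subseteq> B\<close>: elements that agree modulo
    \<open>B'\<close> also agree modulo \<open>B\<close>.\<close>
  have inj: "B +>\<^bsub>M\<^esub> y = B +>\<^bsub>M\<^esub> z" if "B' +>\<^bsub>M\<^esub> y = B' +>\<^bsub>M\<^esub> z" "y \<in> Z'" "z \<in> Z'" for y z
  proof -
    have "y \<in> B' +>\<^bsub>M\<^esub> z"
      using B'.a_rcos_self[OF carr'[OF that(2)]] that(1) by simp
    then have "y \<in> B +>\<^bsub>M\<^esub> z"
      using \<open>B' \<subseteq> B\<close> by (auto simp: a_r_coset_def')
    then show ?thesis
      using B.a_repr_independence' carr' that by metis
  qed
  have "h \<in> module_iso R (quotient_module (M\<lparr>carrier := Z\<rparr>) B)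
              (quotient_module (M\<lparr>carrier := Z'\<rparr>) B')"
    unfolding module_iso_def
  proof (intro CollectI conjI ballI)
    show "bij_betw h (carrier (quotient_module (M\<lparr>carrier := Z\<rparr>) B))
            (carrier (quotient_module (M\<lparr>carrier := Z'\<rparr>) B'))"
      unfolding dom ran
    proof (rule bij_betw_imageI)
      show "inj_on h ((\<lambda>z. B +>\<^bsub>M\<^esub> z) ` Z')"
      proof (rule inj_onI)
        fix X Y assume "X \<in> (\<lambda>z. B +>\<^bsub>M\<^esub> z) ` Z'" "Y \<in> (\<lambda>z. B +>\<^bsub>M\<^esub> z) ` Z'" "h X = h Y"
        then obtain x y where "x \<in> Z'" "y \<in> Z'" "X = B +>\<^bsub>M\<^esub> x" "Y = B +>\<^bsub>M\<^esub> y"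
          by blast
        with \<open>h X = h Y\<close> show "X = Y"
          using inj h by metis
      qed
      show "h ` ((\<lambda>z. B +>\<^bsub>M\<^esub> z) ` Z') = (\<lambda>z. B' +>\<^bsub>M\<^esub> z) ` Z'"
        by (simp add: image_image h)
    qed
  next
    fix X Y
    assume "X \<in> carrier (quotient_module (M\<lparr>carrier := Z\<rparr>) B)"
      and "Y \<in> carrier (quotient_module (M\<lparr>carrier := Z\<rparr>) B)"
    then obtain x y where xy: "x \<in> Z'" "y \<in> Z'" "X = B +>\<^bsub>M\<^esub> x" "Y = B +>\<^bsub>M\<^esub> y"
      unfolding dom by blast
    then show "h (X \<oplus>\<^bsub>quotient_module (M\<lparr>carrier := Z\<rparr>) B\<^esub> Y)
        = h X \<oplus>\<^bsub>quotient_module (M\<lparr>carrier := Z'\<rparr>) B'\<^esub> h Y"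
      using submoduleE(5)[OF Z']
      by (simp add: quotient_module_def sum_update B.a_rcos_sum B'.a_rcos_sum carr' h)
  next
    fix r X
    assume r: "r \<in> carrier R" and "X \<in> carrier (quotient_module (M\<lparr>carrier := Z\<rparr>) B)"
    then obtain x where x: "x \<in> Z'" "X = B +>\<^bsub>M\<^esub> x"
      unfolding dom by blast
    then show "h (r \<odot>\<^bsub>quotient_module (M\<lparr>carrier := Z\<rparr>) B\<^esub> X)
        = r \<odot>\<^bsub>quotient_module (M\<lparr>carrier := Z'\<rparr>) B'\<^esub> h X"
      using submoduleE(4)[OF Z'] r
      by (simp add: quotient_module_def coset_update smult_coset B B' carr' h)
  qed
  then show ?thesis
    unfolding module_isomorphic_def by blast
qed

section \<open>Free modules on finite sets\<close>

lemma free_module_simps: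
  "\<zero>\<^bsub>free_module R A\<^esub> = (\<lambda>_. \<zero>\<^bsub>R\<^esub>)"
  "c \<oplus>\<^bsub>free_module R A\<^esub> d = (\<lambda>b. c b \<oplus>\<^bsub>R\<^esub> d b)"
  "r \<odot>\<^bsub>free_module R A\<^esub> c = (\<lambda>b. r \<otimes>\<^bsub>R\<^esub> c b)"
  by (simp_all add: free_module_def)

lemma carrier_free_module:
  assumes "finite A"
  shows "c \<in> carrier (free_module R A) \<longleftrightarrow>
    (\<forall>b. c b \<in> carrier R) \<and> (\<forall>b. b \<notin> A \<longrightarrow> c b = \<zero>\<^bsub>R\<^esub>)"
  using assms by (auto simp: free_module_def intro: finite_subset)

lemma module_free_module:
  assumes "cring R" and "finite A"
  shows "module R (free_module R A)"
proof -
  interpret cring R by fact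
  note fm = free_module_simps carrier_free_module[OF \<open>finite A\<close>]
  have "abelian_group (free_module R A)"
  proof (rule abelian_groupI)
    fix c assume "c \<in> carrier (free_module R A)"
    then have "(\<lambda>b. \<ominus>\<^bsub>R\<^esub> c b) \<in> carrier (free_module R A)"
      "(\<lambda>b. \<ominus>\<^bsub>R\<^esub> c b) \<oplus>\<^bsub>free_module R A\<^esub> c = \<zero>\<^bsub>free_module R A\<^esub>"
      by (auto simp: fm l_neg)
    then show "\<exists>d\<in>carrier (free_module R A). d \<oplus>\<^bsub>free_module R A\<^esub> c = \<zero>\<^bsub>free_module R A\<^esub>"
      by blast
  qed (auto simp: fm a_ac)
  then show ?thesis
    by (rule moduleI[OF \<open>cring R\<close>]) (auto simp: fm l_distr r_distr m_assoc)
qed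

text \<open>Evaluation at \<open>b\<close> is additive, so an identity between sums of chains can be
  checked coefficientwise in \<open>R\<close>.\<close>

lemma free_module_finsum_apply:
  assumes "cring R" and "finite A"
    and "f \<in> I \<rightarrow> carrier (free_module R A)"
  shows "finsum (free_module R A) f I b = (\<Oplus>\<^bsub>R\<^esub>i\<in>I. f i b)"
proof -
  interpret cring R by fact
  interpret M: module R "free_module R A"
    using module_free_module assms by blast
  show ?thesis
  proof (cases "finite I")
    case True
    then show ?thesis
      using \<open>f \<in> I \<rightarrow> carrier (free_module R A)\<close>
    proof (induction I rule: finite_induct)
      case (insert i I)
      moreover have "(\<lambda>j. f j b) \<in> I \<rightarrow> carrier R"
        using insert.prems \<open>finite A\<close> by (force simp: carrier_free_module Pi_def)
      ultimately show ?case
        using \<open>finite A\<close> by (auto simp: free_module_simps carrier_free_module)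
    qed (simp add: free_module_simps)
  \<comment> \<open>For infinite \<open>I\<close>, both sums take the default value zero.\<close>
  qed (simp add: M.M.finsum_infinite finsum_infinite free_module_simps)
qed


section \<open>Weighted boundary maps\<close>

lemma (in abelian_monoid) finsum_doubleton:
  assumes "a \<noteq> b" and "f a \<in> carrier G" and "f b \<in> carrier G"
  shows "finsum G f {a, b} = f a \<oplus> f b"
  using assms by simp

section \<open>Exact division in an integral domain\<close>

context "domain"
begin

lemma zero_not_in_Units: "\<zero> \<notin> Units R"
  by (auto simp: Units_def)

text \<open>Cancellation of \<open>b\<close> makes the quotient unique, which justifies the definite
  description in \<open>quot\<close>.\<close>

lemma quot_eqI:
  assumes "b \<in> carrier R" and "b \<noteq> \<zero>" and "q \<in> carrier R" and "a = b \<otimes> q"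
  shows "quot R a b = q"
  unfolding quot_def
proof (rule the_equality)
  fix q' assume "q' \<in> carrier R \<and> a = b \<otimes> q'"
  then show "q' = q"
    using assms m_lcancel by metis
qed (use assms in auto)

lemma
  assumes "b divides a" and "b \<in> carrier R" and "b \<noteq> \<zero>"
  shows quot_closed: "quot R a b \<in> carrier R"
    and mult_quot: "b \<otimes> quot R a b = a"
  using assms by (auto simp: factor_def quot_eqI)

text \<open>Applied to weights along a chain of faces, this shows that the product of the two
  quotients does not depend on the intermediate face.\<close>

lemma quot_mult_quot:
  assumes "c divides b" and "b divides a"
    and "c \<in> carrier R" and "c \<noteq> \<zero>" and "b \<in> carrier R" and "b \<noteq> \<zero>"
  shows "quot R a b \<otimes> quot R b c = quot R a c"
proof (rule quot_eqI[symmetric])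
  have "c \<otimes> (quot R a b \<otimes> quot R b c) = c \<otimes> quot R b c \<otimes> quot R a b"
    using assms quot_closed by (simp add: m_ac)
  then show "a = c \<otimes> (quot R a b \<otimes> quot R b c)"
    using assms by (simp add: mult_quot)
qed (use assms quot_closed in auto)

end

section \<open>Vertex positions and incidence numbers\<close>

lemma card_less_nth_sorted_list_of_set:
  fixes A :: "'a::linorder set"
  assumes "finite A" and "i < card A"
  shows "card {x \<in> A. x < sorted_list_of_set A ! i} = i"
proof -
  let ?xs = "sorted_list_of_set A"
  have len: "length ?xs = card A" and st: "sorted_wrt (<) ?xs"
    by simp_all
  \<comment> \<open>The list is strictly increasing, so comparing entries amounts to comparing
    indices.\<close>
  have less: "?xs ! j < ?xs ! i \<longleftrightarrow> j < i" if "j < card A" for j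
    using that assms st len by (metis linorder_neqE_nat order_less_asym sorted_wrt_nth_less order_less_irrefl)
  have "A = (!) ?xs ` {..<card A}"
    using assms len set_sorted_list_of_set[OF assms(1)] by (auto simp: set_conv_nth)
  then have "{x \<in> A. x < ?xs ! i} = (!) ?xs ` {..<i}"
    using less assms by fastforce
  moreover have "inj_on ((!) ?xs) {..<i}"
    using assms by (intro inj_on_nth) auto
  ultimately show ?thesis
    by (simp add: card_image)
qed

text \<open>
  The coefficient of \<open>\<rho>\<close> in the boundary of \<open>\<sigma>\<close>. For a facet \<open>\<rho>\<close>, the set \<open>\<sigma> - \<rho>\<close> is a
  singleton, and the exponent of the sign is the position of its element in \<open>\<sigma>\<close>.
\<close>

definition incidence ::
  "('r, 'm) ring_scheme \<Rightarrow> ('v::linorder set \<Rightarrow> 'r) \<Rightarrow> 'v set \<Rightarrow> 'v set \<Rightarrow> 'r" where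
  "incidence R w \<sigma> \<rho> =
     (if \<exists>v\<in>\<sigma>. \<rho> = \<sigma> - {v}
      then quot R (w \<sigma>) (w \<rho>) \<otimes>\<^bsub>R\<^esub> (\<ominus>\<^bsub>R\<^esub> \<one>\<^bsub>R\<^esub>) [^]\<^bsub>R\<^esub> card {x \<in> \<sigma>. \<forall>v\<in>\<sigma> - \<rho>. x < v}
      else \<zero>\<^bsub>R\<^esub>)"

lemma incidence_facet:
  assumes "v \<in> \<sigma>"
  shows "incidence R w \<sigma> (\<sigma> - {v}) =
    quot R (w \<sigma>) (w (\<sigma> - {v})) \<otimes>\<^bsub>R\<^esub> (\<ominus>\<^bsub>R\<^esub> \<one>\<^bsub>R\<^esub>) [^]\<^bsub>R\<^esub> card {x \<in> \<sigma>. x < v}"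
proof -
  have "\<sigma> - (\<sigma> - {v}) = {v}"
    using assms by blast
  then show ?thesis
    using assms by (auto simp: incidence_def)
qed

lemma incidence_eq_zero:
  "\<not> (\<exists>v\<in>\<sigma>. \<rho> = \<sigma> - {v}) \<Longrightarrow> incidence R w \<sigma> \<rho> = \<zero>\<^bsub>R\<^esub>"
  by (auto simp: incidence_def)

section \<open>Chain modules and boundaries of simplices\<close>

locale weighted_simplicial_complex = "domain" R for R (structure) +
  fixes K :: "'v::linorder set set" and w :: "'v set \<Rightarrow> 'a"
  assumes weighted_complex: "weighted_complex R K w"
begin

lemma finite_simplex: "\<sigma> \<in> K \<Longrightarrow> finite \<sigma>"
  and face_closed: "\<sigma> \<in> K \<Longrightarrow> \<rho> \<subseteq> \<sigma> \<Longrightarrow> \<rho> \<noteq> {} \<Longrightarrow> \<rho> \<in> K"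
  and weight_closed: "\<sigma> \<in> K \<Longrightarrow> w \<sigma> \<in> carrier R"
  and weight_divides: "\<rho> \<in> K \<Longrightarrow> \<sigma> \<in> K \<Longrightarrow> \<rho> \<subseteq> \<sigma> \<Longrightarrow> w \<rho> divides w \<sigma>"
  using weighted_complex unfolding weighted_complex_def simplicial_complex_def by blast+

lemma finite_weighted_basis: "finite (weighted_basis R K w n)"
  using weighted_complex
  by (simp add: weighted_complex_def simplicial_complex_def weighted_basis_def)

lemma module_weighted_chains: "module R (weighted_chains R K w n)"
  unfolding weighted_chains_def using is_cring finite_weighted_basis by (rule module_free_module)

lemma carrier_weighted_chains:
  "c \<in> carrier (weighted_chains R K w n) \<longleftrightarrow>
    (\<forall>\<sigma>. c \<sigma> \<in> carrier R) \<and> (\<forall>\<sigma>. \<sigma> \<notin> weighted_basis R K w n \<longrightarrow> c \<sigma> = \<zero>)"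
  unfolding weighted_chains_def using finite_weighted_basis by (rule carrier_free_module)

lemma weighted_chains_simps:
  "\<zero>\<^bsub>weighted_chains R K w n\<^esub> = (\<lambda>_. \<zero>)"
  "c \<oplus>\<^bsub>weighted_chains R K w n\<^esub> d = (\<lambda>\<sigma>. c \<sigma> \<oplus> d \<sigma>)"
  "r \<odot>\<^bsub>weighted_chains R K w n\<^esub> c = (\<lambda>\<sigma>. r \<otimes> c \<sigma>)"
  by (simp_all add: weighted_chains_def free_module_simps)

lemma weighted_chains_finsum_apply:
  "f \<in> I \<rightarrow> carrier (weighted_chains R K w n) \<Longrightarrow>
    finsum (weighted_chains R K w n) f I \<sigma> = (\<Oplus>i\<in>I. f i \<sigma>)"
  unfolding weighted_chains_def using is_cring finite_weighted_basis by (rule free_module_finsum_apply)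

text \<open>Zero divides only zero, and the weight of a face divides the weight of the
  simplex.\<close>

lemma weight_nonzero_face:
  assumes "\<sigma> \<in> K" and "w \<sigma> \<noteq> \<zero>" and "\<rho> \<subseteq> \<sigma>" and "\<rho> \<noteq> {}"
  shows "w \<rho> \<noteq> \<zero>"
  using weight_divides[OF face_closed[OF assms(1,3,4)] assms(1,3)] assms(2)
  by (auto simp: factor_def)

text \<open>Simplices are nonempty, so the truncated subtraction in \<open>sdim\<close> loses
  nothing, even for \<open>n = 0\<close>.\<close>

lemma weighted_basis_card:
  "\<sigma> \<in> weighted_basis R K w n \<Longrightarrow> card \<sigma> = Suc n"
  using weighted_complex card_gt_0_iff[of \<sigma>]
  unfolding weighted_basis_def sdim_def weighted_complex_def simplicial_complex_def by fastforce

text \<open>The facet keeps \<open>Suc n\<close> vertices, so it is nonempty and belongs to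
  \<open>K\<close>, and its weight is nonzero. Hence all quotients in the boundary formula have
  nonzero denominators.\<close>

lemma facet_in_weighted_basis:
  assumes "\<sigma> \<in> weighted_basis R K w (Suc n)" and "v \<in> \<sigma>"
  shows "\<sigma> - {v} \<in> weighted_basis R K w n"
proof -
  have \<sigma>: "\<sigma> \<in> K" "w \<sigma> \<noteq> \<zero>" "card \<sigma> = Suc (Suc n)"
    using assms weighted_basis_card by (auto simp: weighted_basis_def)
  then have "card (\<sigma> - {v}) = Suc n"
    using assms(2) by simp
  moreover from this have "\<sigma> - {v} \<noteq> {}"
    by (metis card.empty nat.distinct(1))
  ultimately show ?thesis
    using \<sigma> face_closed[of \<sigma> "\<sigma> - {v}"] weight_nonzero_face[of \<sigma> "\<sigma> - {v}"]
    by (auto simp: weighted_basis_def sdim_def)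
qed

lemma facet_quot_closed:
  assumes "\<sigma> \<in> weighted_basis R K w (Suc n)" and "v \<in> \<sigma>"
  shows "quot R (w \<sigma>) (w (\<sigma> - {v})) \<in> carrier R"
  using assms(1) facet_in_weighted_basis[OF assms]
  by (intro quot_closed weight_divides weight_closed) (auto simp: weighted_basis_def)

lemma incidence_in_chains:
  assumes "\<sigma> \<in> weighted_basis R K w (Suc n)"
  shows "incidence R w \<sigma> \<in> carrier (weighted_chains R K w n)"
  unfolding carrier_weighted_chains
proof (intro conjI allI impI)
  show "incidence R w \<sigma> \<rho> \<in> carrier R" for \<rho>
  proof (cases "\<exists>v\<in>\<sigma>. \<rho> = \<sigma> - {v}")
    case True
    then obtain v where v: "v \<in> \<sigma>" "\<rho> = \<sigma> - {v}"
      by blast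
    show ?thesis
      unfolding v(2) incidence_facet[OF v(1)]
      by (intro m_closed nat_pow_closed a_inv_closed one_closed facet_quot_closed[OF assms v(1)])
  qed (simp add: incidence_eq_zero)
  show "incidence R w \<sigma> \<rho> = \<zero>" if "\<rho> \<notin> weighted_basis R K w n" for \<rho>
    using that facet_in_weighted_basis[OF assms] by (intro incidence_eq_zero) auto
qed

lemma incidence_closed:
  "\<sigma> \<in> weighted_basis R K w (Suc n) \<Longrightarrow> incidence R w \<sigma> \<rho> \<in> carrier R"
  using incidence_in_chains carrier_weighted_chains by blast

text \<open>Deleting different vertices gives different facets, so at most one summand contributes
  to the coefficient of a given face. This trades the indexed sum for a formula in terms of
  sets.\<close>

lemma simplex_boundary_eq_incidence:
  assumes "\<sigma> \<in> weighted_basis R K w (Suc n)"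
  shows "simplex_boundary R K w n \<sigma> = incidence R w \<sigma>"
proof
  fix \<rho>
  let ?xs = "sorted_list_of_set \<sigma>"
  let ?coeff = "\<lambda>i. quot R (w \<sigma>) (w (dface i \<sigma>)) \<otimes> (\<ominus> \<one>) [^] i"
  have \<sigma>: "finite \<sigma>" "card \<sigma> = Suc (Suc n)"
    using assms weighted_basis_card finite_simplex by (auto simp: weighted_basis_def)
  have vertex: "?xs ! i \<in> \<sigma>" if "i \<in> {..Suc n}" for i
    using \<sigma> that by (metis atMost_iff length_sorted_list_of_set less_Suc_eq_le nth_mem
        set_sorted_list_of_set)
  have coeff: "?coeff i \<in> carrier R" if "i \<in> {..Suc n}" for i
    using facet_quot_closed[OF assms vertex[OF that]] by (simp add: dface_def)
  have "?coeff i \<odot>\<^bsub>weighted_chains R K w n\<^esub> basis_elem R (dface i \<sigma>)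
      \<in> carrier (weighted_chains R K w n)" if "i \<in> {..Suc n}" for i
    using coeff[OF that] facet_in_weighted_basis[OF assms vertex[OF that]]
    by (auto simp: weighted_chains_simps carrier_weighted_chains basis_elem_def dface_def)
  then have "simplex_boundary R K w n \<sigma> \<rho> = (\<Oplus>i\<in>{..Suc n}. ?coeff i \<otimes> basis_elem R (dface i \<sigma>) \<rho>)"
    unfolding simplex_boundary_def by (subst weighted_chains_finsum_apply) (auto simp: weighted_chains_simps)
  also have "\<dots> = incidence R w \<sigma> \<rho>"
  proof (cases "\<exists>v\<in>\<sigma>. \<rho> = \<sigma> - {v}")
    case True
    then obtain v where v: "v \<in> \<sigma>" "\<rho> = \<sigma> - {v}"
      by blast
    then obtain k where k: "k < Suc (Suc n)" "v = ?xs ! k"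
      using \<sigma> by (metis in_set_conv_nth length_sorted_list_of_set set_sorted_list_of_set)
    have "\<rho> = dface i \<sigma> \<longleftrightarrow> k = i" if "i \<le> Suc n" for i
    proof -
      have "?xs ! k \<in> \<sigma>" "?xs ! i \<in> \<sigma>"
        using v k vertex that by auto
      then have "\<rho> = dface i \<sigma> \<longleftrightarrow> ?xs ! k = ?xs ! i"
        unfolding v(2) k(2) dface_def by (metis Diff_iff insert_iff empty_iff)
      then show ?thesis
        using k that \<sigma> by (simp add: nth_eq_iff_index_eq)
    qed
    then have "(\<Oplus>i\<in>{..Suc n}. ?coeff i \<otimes> basis_elem R (dface i \<sigma>) \<rho>)
        = (\<Oplus>i\<in>{..Suc n}. if k = i then ?coeff i else \<zero>)"
      using coeff by (intro finsum_cong') (auto simp: basis_elem_def)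
    also have "\<dots> = ?coeff k"
      using k coeff by (intro finsum_singleton) auto
    \<comment> \<open>Exactly \<open>k\<close> vertices lie below the entry at index
      \<open>k\<close>, so the exponents of the sign agree.\<close>
    also have "\<dots> = incidence R w \<sigma> \<rho>"
      using v k \<sigma> card_less_nth_sorted_list_of_set[of \<sigma> k]
      by (simp add: incidence_facet dface_def)
    finally show ?thesis .
  next
    case False
    then have "\<rho> \<noteq> dface i \<sigma>" if "i \<le> Suc n" for i
      using vertex that by (auto simp: dface_def)
    then have "(\<Oplus>i\<in>{..Suc n}. ?coeff i \<otimes> basis_elem R (dface i \<sigma>) \<rho>) = (\<Oplus>i\<in>{..Suc n}. \<zero>)"
      using coeff by (intro finsum_cong') (auto simp: basis_elem_def)
    then show ?thesis
      using False by (simp add: incidence_eq_zero finsum_zero)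
  qed
  finally show "simplex_boundary R K w n \<sigma> \<rho> = incidence R w \<sigma> \<rho>" .
qed

section \<open>The boundary map: matrix form, linearity and vanishing square\<close>

lemma weighted_boundary_Suc_apply:
  assumes "c \<in> carrier (weighted_chains R K w (Suc n))"
  shows "weighted_boundary R K w (Suc n) c \<rho> =
    (\<Oplus>\<sigma>\<in>weighted_basis R K w (Suc n). c \<sigma> \<otimes> incidence R w \<sigma> \<rho>)"
proof -
  interpret M: module R "weighted_chains R K w n"
    by (rule module_weighted_chains)
  have "c \<sigma> \<odot>\<^bsub>weighted_chains R K w n\<^esub> simplex_boundary R K w n \<sigma>
      \<in> carrier (weighted_chains R K w n)" if "\<sigma> \<in> weighted_basis R K w (Suc n)" for \<sigma>
    using assms that incidence_in_chains
    by (intro M.smult_closed) (auto simp: carrier_weighted_chains simplex_boundary_eq_incidence)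
  then have "weighted_boundary R K w (Suc n) c \<rho> = (\<Oplus>\<sigma>\<in>weighted_basis R K w (Suc n).
      (c \<sigma> \<odot>\<^bsub>weighted_chains R K w n\<^esub> simplex_boundary R K w n \<sigma>) \<rho>)"
    by (simp add: weighted_chains_finsum_apply)
  also have "\<dots> = (\<Oplus>\<sigma>\<in>weighted_basis R K w (Suc n). c \<sigma> \<otimes> incidence R w \<sigma> \<rho>)"
    using assms incidence_closed
    by (intro finsum_cong')
      (auto simp: weighted_chains_simps carrier_weighted_chains simplex_boundary_eq_incidence)
  finally show ?thesis .
qed

lemma weighted_boundary_summand_closed:
  assumes "c \<in> carrier (weighted_chains R K w (Suc n))"
  shows "(\<lambda>\<sigma>. c \<sigma> \<otimes> incidence R w \<sigma> \<rho>) \<in> weighted_basis R K w (Suc n) \<rightarrow> carrier R"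
  using assms incidence_closed by (auto simp: carrier_weighted_chains)

lemma weighted_boundary_Suc_closed:
  assumes "c \<in> carrier (weighted_chains R K w (Suc n))"
  shows "weighted_boundary R K w (Suc n) c \<in> carrier (weighted_chains R K w n)"
  unfolding carrier_weighted_chains weighted_boundary_Suc_apply[OF assms]
proof (intro conjI allI impI)
  show "(\<Oplus>\<sigma>\<in>weighted_basis R K w (Suc n). c \<sigma> \<otimes> incidence R w \<sigma> \<rho>) \<in> carrier R" for \<rho>
    by (intro finsum_closed weighted_boundary_summand_closed assms)
  show "(\<Oplus>\<sigma>\<in>weighted_basis R K w (Suc n). c \<sigma> \<otimes> incidence R w \<sigma> \<rho>) = \<zero>"
    if "\<rho> \<notin> weighted_basis R K w n" for \<rho>
  proof -
    have "incidence R w \<sigma> \<rho> = \<zero>" if "\<sigma> \<in> weighted_basis R K w (Suc n)" for \<sigma>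
      using incidence_in_chains[OF that] \<open>\<rho> \<notin> _\<close> by (simp add: carrier_weighted_chains)
    then have "(\<Oplus>\<sigma>\<in>weighted_basis R K w (Suc n). c \<sigma> \<otimes> incidence R w \<sigma> \<rho>)
        = (\<Oplus>\<sigma>\<in>weighted_basis R K w (Suc n). \<zero>)"
      using assms by (intro finsum_cong') (auto simp: carrier_weighted_chains)
    then show ?thesis
      by (simp add: finsum_zero)
  qed
qed

lemma weighted_boundary_add:
  assumes "c \<in> carrier (weighted_chains R K w n)" and "d \<in> carrier (weighted_chains R K w n)"
  shows "weighted_boundary R K w n (\<lambda>\<sigma>. c \<sigma> \<oplus> d \<sigma>) =
    (\<lambda>\<rho>. weighted_boundary R K w n c \<rho> \<oplus> weighted_boundary R K w n d \<rho>)"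
proof (cases n)
  case (Suc k)
  interpret M: module R "weighted_chains R K w n"
    by (rule module_weighted_chains)
  have cd: "(\<lambda>\<sigma>. c \<sigma> \<oplus> d \<sigma>) \<in> carrier (weighted_chains R K w n)"
    using M.M.a_closed[OF assms] by (simp add: weighted_chains_simps)
  have "(\<Oplus>\<sigma>\<in>weighted_basis R K w n. (c \<sigma> \<oplus> d \<sigma>) \<otimes> incidence R w \<sigma> \<rho>)
      = (\<Oplus>\<sigma>\<in>weighted_basis R K w n. c \<sigma> \<otimes> incidence R w \<sigma> \<rho> \<oplus> d \<sigma> \<otimes> incidence R w \<sigma> \<rho>)" for \<rho>
    using assms incidence_closed unfolding Suc
    by (intro finsum_cong') (auto simp: carrier_weighted_chains l_distr)
  then show ?thesis
    using assms cd weighted_boundary_summand_closed unfolding Suc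
    by (simp add: fun_eq_iff weighted_boundary_Suc_apply finsum_addf del: weighted_boundary.simps)
qed simp

lemma weighted_boundary_smult:
  assumes "r \<in> carrier R" and "c \<in> carrier (weighted_chains R K w n)"
  shows "weighted_boundary R K w n (\<lambda>\<sigma>. r \<otimes> c \<sigma>) = (\<lambda>\<rho>. r \<otimes> weighted_boundary R K w n c \<rho>)"
proof (cases n)
  case (Suc k)
  interpret M: module R "weighted_chains R K w n"
    by (rule module_weighted_chains)
  have rc: "(\<lambda>\<sigma>. r \<otimes> c \<sigma>) \<in> carrier (weighted_chains R K w n)"
    using M.smult_closed[OF assms] by (simp add: weighted_chains_simps)
  have "(\<Oplus>\<sigma>\<in>weighted_basis R K w n. r \<otimes> c \<sigma> \<otimes> incidence R w \<sigma> \<rho>)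
      = (\<Oplus>\<sigma>\<in>weighted_basis R K w n. r \<otimes> (c \<sigma> \<otimes> incidence R w \<sigma> \<rho>))" for \<rho>
    using assms incidence_closed unfolding Suc
    by (intro finsum_cong') (auto simp: carrier_weighted_chains m_assoc)
  then show ?thesis
    using assms rc weighted_boundary_summand_closed finite_weighted_basis unfolding Suc
    by (simp add: fun_eq_iff weighted_boundary_Suc_apply finsum_rdistr del: weighted_boundary.simps)
qed (use assms in simp)

lemma weighted_boundary_zero: "weighted_boundary R K w n (\<lambda>_. \<zero>) = (\<lambda>_. \<zero>)"
  using weighted_boundary_smult[of \<zero> "\<lambda>_. \<zero>" n] by (cases n)
    (simp_all add: carrier_weighted_chains weighted_boundary_Suc_apply finsum_zero incidence_closed
      del: weighted_boundary.simps(2))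

text \<open>A face of codimension two, \<open>\<tau> - {a, b}\<close>, is reached through exactly
  two facets of \<open>\<tau>\<close>. The weight quotients have the same product along both ways,
  while the signs are opposite, so the two terms cancel.\<close>

lemma sum_incidence_mult_incidence:
  assumes \<tau>: "\<tau> \<in> weighted_basis R K w (Suc (Suc n))"
  shows "(\<Oplus>\<sigma>\<in>weighted_basis R K w (Suc n). incidence R w \<tau> \<sigma> \<otimes> incidence R w \<sigma> \<rho>) = \<zero>"
proof -
  let ?t = "\<lambda>\<sigma>. incidence R w \<tau> \<sigma> \<otimes> incidence R w \<sigma> \<rho>"
  have closed: "?t \<in> weighted_basis R K w (Suc n) \<rightarrow> carrier R"
    using incidence_closed[OF \<tau>] incidence_closed by auto
  have nonzero: "\<exists>a\<in>\<tau>. \<exists>b\<in>\<tau>. a \<noteq> b \<and> \<sigma> = \<tau> - {a} \<and> \<rho> = \<tau> - {a, b}"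
    if "\<sigma> \<in> weighted_basis R K w (Suc n)" "?t \<sigma> \<noteq> \<zero>" for \<sigma>
  proof -
    have "incidence R w \<tau> \<sigma> \<noteq> \<zero>" "incidence R w \<sigma> \<rho> \<noteq> \<zero>"
      using that(2) incidence_closed[OF \<tau>] incidence_closed[OF that(1)] by auto
    then obtain a b where ab: "a \<in> \<tau>" "\<sigma> = \<tau> - {a}" "b \<in> \<sigma>" "\<rho> = \<sigma> - {b}"
      by (metis incidence_eq_zero)
    then have "b \<in> \<tau>" "a \<noteq> b" "\<rho> = \<tau> - {a, b}"
      by auto
    with ab show ?thesis
      by blast
  qed
  show ?thesis
  proof (cases "\<exists>a\<in>\<tau>. \<exists>b\<in>\<tau>. a \<noteq> b \<and> \<rho> = \<tau> - {a, b}")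
    case False
    have "?t \<sigma> = \<zero>" if "\<sigma> \<in> weighted_basis R K w (Suc n)" for \<sigma>
      using nonzero[OF that] False by metis
    then have "(\<Oplus>\<sigma>\<in>weighted_basis R K w (Suc n). ?t \<sigma>) = (\<Oplus>\<sigma>\<in>weighted_basis R K w (Suc n). \<zero>)"
      by (intro finsum_cong') auto
    then show ?thesis
      by (simp add: finsum_zero)
  next
    case True
    then obtain a b where ab: "a \<in> \<tau>" "b \<in> \<tau>" "a < b" "\<rho> = \<tau> - {a, b}"
      by (metis insert_commute linorder_neqE)
    have faces: "\<tau> - {a} \<in> weighted_basis R K w (Suc n)" "\<tau> - {b} \<in> weighted_basis R K w (Suc n)"
      using facet_in_weighted_basis[OF \<tau>] ab by auto
    have \<rho>: "\<rho> = \<tau> - {a} - {b}" "\<rho> = \<tau> - {b} - {a}"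
      using ab by auto
    \<comment> \<open>\<open>\<rho>\<close> determines the pair of deleted vertices, so the
      intermediate facet omits \<open>a\<close> or \<open>b\<close>.\<close>
    have two: "?t \<sigma> = \<zero>" if \<sigma>: "\<sigma> \<in> weighted_basis R K w (Suc n) - {\<tau> - {a}, \<tau> - {b}}" for \<sigma>
    proof (rule ccontr)
      assume "?t \<sigma> \<noteq> \<zero>"
      then obtain a' b' where "a' \<in> \<tau>" "b' \<in> \<tau>" "\<sigma> = \<tau> - {a'}" "\<rho> = \<tau> - {a', b'}"
        using nonzero[of \<sigma>] \<sigma> by blast
      then have "a' \<in> {a, b}"
        using ab(4) by auto
      then show False
        using \<sigma> \<open>\<sigma> = \<tau> - {a'}\<close> by auto
    qed
    have Q: "quot R (w \<tau>) (w (\<tau> - {v})) \<otimes> quot R (w (\<tau> - {v})) (w \<rho>) = quot R (w \<tau>) (w \<rho>)"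
      and qc: "quot R (w \<tau>) (w (\<tau> - {v})) \<in> carrier R" "quot R (w (\<tau> - {v})) (w \<rho>) \<in> carrier R"
      if v: "v \<in> {a, b}" for v
    proof -
      obtain v' where v': "v' \<in> \<tau> - {v}" "\<rho> = \<tau> - {v} - {v'}"
        using v ab(1,2,3) \<rho> by fastforce
      have f: "\<tau> - {v} \<in> weighted_basis R K w (Suc n)"
        using faces v by blast
      have g: "\<rho> \<in> weighted_basis R K w n"
        using facet_in_weighted_basis[OF f v'(1)] v'(2) by simp
      show "quot R (w \<tau>) (w (\<tau> - {v})) \<in> carrier R" "quot R (w (\<tau> - {v})) (w \<rho>) \<in> carrier R"
        using facet_quot_closed[OF \<tau>] facet_quot_closed[OF f v'(1)] v v' ab by auto
      show "quot R (w \<tau>) (w (\<tau> - {v})) \<otimes> quot R (w (\<tau> - {v})) (w \<rho>) = quot R (w \<tau>) (w \<rho>)"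
        using \<tau> f g v' by (intro quot_mult_quot weight_divides weight_closed)
          (auto simp: weighted_basis_def)
    qed
    \<comment> \<open>As \<open>a < b\<close>, deleting \<open>a\<close> moves \<open>b\<close> down
      by one position, while deleting \<open>b\<close> leaves the position of \<open>a\<close>
      unchanged. This one shift makes the signs opposite.\<close>
    let ?p = "card {x \<in> \<tau>. x < a}" and ?q = "card {x \<in> \<tau> - {a}. x < b}"
    have "finite \<tau>"
      using \<tau> finite_simplex by (simp add: weighted_basis_def)
    moreover have "{x \<in> \<tau>. x < b} = insert a {x \<in> \<tau> - {a}. x < b}"
      using ab by auto
    ultimately have q: "card {x \<in> \<tau>. x < b} = Suc ?q"
      by simp
    have p: "{x \<in> \<tau> - {b}. x < a} = {x \<in> \<tau>. x < a}"
      using ab by auto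
    let ?s = "(\<ominus> \<one>) [^] ?p" and ?s' = "(\<ominus> \<one>) [^] ?q"
    have "?t (\<tau> - {a}) = quot R (w \<tau>) (w (\<tau> - {a})) \<otimes> ?s \<otimes> (quot R (w (\<tau> - {a})) (w \<rho>) \<otimes> ?s')"
      using incidence_facet[of b "\<tau> - {a}" R w, folded \<rho>(1)] ab(1,2,3)
      by (simp add: incidence_facet)
    also have "\<dots> = quot R (w \<tau>) (w (\<tau> - {a})) \<otimes> quot R (w (\<tau> - {a})) (w \<rho>) \<otimes> (?s \<otimes> ?s')"
      using qc[of a] by (simp add: m_ac)
    finally have ta: "?t (\<tau> - {a}) = quot R (w \<tau>) (w \<rho>) \<otimes> (?s \<otimes> ?s')"
      using Q[of a] by simp
    have "?t (\<tau> - {b}) = quot R (w \<tau>) (w (\<tau> - {b})) \<otimes> (?s' \<otimes> \<ominus> \<one>)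
        \<otimes> (quot R (w (\<tau> - {b})) (w \<rho>) \<otimes> ?s)"
      using incidence_facet[of a "\<tau> - {b}" R w, folded \<rho>(2)] ab(1,2,3)
      by (simp add: incidence_facet q p[simplified])
    also have "\<dots> = \<ominus> (quot R (w \<tau>) (w (\<tau> - {b})) \<otimes> quot R (w (\<tau> - {b})) (w \<rho>) \<otimes> (?s \<otimes> ?s'))"
      using qc[of b] by (simp add: m_ac r_minus l_minus)
    finally have tb: "?t (\<tau> - {b}) = \<ominus> (quot R (w \<tau>) (w \<rho>) \<otimes> (?s \<otimes> ?s'))"
      using Q[of b] by simp
    have Qc: "quot R (w \<tau>) (w \<rho>) \<in> carrier R"
      using Q[of a] qc[of a] by (metis insertI1 m_closed)
    have "(\<Oplus>\<sigma>\<in>weighted_basis R K w (Suc n). ?t \<sigma>) = (\<Oplus>\<sigma>\<in>{\<tau> - {a}, \<tau> - {b}}. ?t \<sigma>)"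
      using faces two closed finite_weighted_basis by (intro add.finprod_mono_neutral_cong_right) auto
    also have "\<dots> = ?t (\<tau> - {a}) \<oplus> ?t (\<tau> - {b})"
    proof -
      have "\<tau> - {a} \<noteq> \<tau> - {b}"
        using ab by blast
      then show ?thesis
        by (intro finsum_doubleton funcset_mem[OF closed] faces)
    qed
    also have "\<dots> = \<zero>"
      unfolding ta tb using Qc by (simp add: r_neg)
    finally show ?thesis .
  qed
qed

text \<open>\<open>incidence R w \<tau>\<close> is the boundary of \<open>\<tau>\<close>, so its own
  boundary is zero. Adding a multiple of it to a chain therefore leaves the boundary of the chain
  unchanged.\<close>

lemma weighted_boundary_incidence:
  assumes "\<tau> \<in> weighted_basis R K w (Suc n)"
  shows "weighted_boundary R K w n (incidence R w \<tau>) = (\<lambda>_. \<zero>)"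
proof (cases n)
  case (Suc k)
  then show ?thesis
    using assms incidence_in_chains[OF assms]
    by (simp add: weighted_boundary_Suc_apply sum_incidence_mult_incidence fun_eq_iff
        del: weighted_boundary.simps)
qed simp

text \<open>The preimage is \<open>basis_elem R \<tau>\<close>: in the matrix form of its boundary
  only the summand at \<open>\<tau>\<close> survives.\<close>

lemma incidence_in_boundaries:
  assumes "\<tau> \<in> weighted_basis R K w (Suc n)"
  shows "incidence R w \<tau> \<in> weighted_boundaries R K w n"
proof -
  have e: "basis_elem R \<tau> \<in> carrier (weighted_chains R K w (Suc n))"
    using assms by (auto simp: carrier_weighted_chains basis_elem_def)
  have "weighted_boundary R K w (Suc n) (basis_elem R \<tau>) \<rho> = incidence R w \<tau> \<rho>" for \<rho>
  proof -
    have "(\<Oplus>\<sigma>\<in>weighted_basis R K w (Suc n). basis_elem R \<tau> \<sigma> \<otimes> incidence R w \<sigma> \<rho>)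
        = (\<Oplus>\<sigma>\<in>weighted_basis R K w (Suc n). if \<tau> = \<sigma> then incidence R w \<sigma> \<rho> else \<zero>)"
      using incidence_closed by (intro finsum_cong') (auto simp: basis_elem_def)
    also have "\<dots> = incidence R w \<tau> \<rho>"
      using assms incidence_closed finite_weighted_basis by (intro finsum_singleton) auto
    finally show ?thesis
      using e by (simp add: weighted_boundary_Suc_apply del: weighted_boundary.simps)
  qed
  then have "weighted_boundary R K w (Suc n) (basis_elem R \<tau>) = incidence R w \<tau>"
    by blast
  then show ?thesis
    using e unfolding weighted_boundaries_def by (metis image_eqI)
qed

section \<open>Cycles and boundaries as submodules\<close>

lemma submodule_weighted_cycles:
  "submodule (weighted_cycles R K w n) R (weighted_chains R K w n)"
proof -
  interpret M: module R "weighted_chains R K w n"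
    by (rule module_weighted_chains)
  show ?thesis
  proof (rule M.submoduleI')
    show "\<zero>\<^bsub>weighted_chains R K w n\<^esub> \<in> weighted_cycles R K w n"
      using M.M.zero_closed
      by (simp add: weighted_cycles_def weighted_chains_simps weighted_boundary_zero)
  next
    fix x y assume "x \<in> weighted_cycles R K w n" "y \<in> weighted_cycles R K w n"
    then show "x \<oplus>\<^bsub>weighted_chains R K w n\<^esub> y \<in> weighted_cycles R K w n"
      using M.M.a_closed[of x y]
      by (simp add: weighted_cycles_def weighted_chains_simps weighted_boundary_add)
  next
    fix r x assume "r \<in> carrier R" "x \<in> weighted_cycles R K w n"
    then show "r \<odot>\<^bsub>weighted_chains R K w n\<^esub> x \<in> weighted_cycles R K w n"
      using M.smult_closed[of r x]
      by (simp add: weighted_cycles_def weighted_chains_simps weighted_boundary_smult)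
  qed (auto simp: weighted_cycles_def)
qed

lemma submodule_weighted_boundaries:
  "submodule (weighted_boundaries R K w n) R (weighted_chains R K w n)"
proof -
  interpret M: module R "weighted_chains R K w n"
    by (rule module_weighted_chains)
  interpret C: module R "weighted_chains R K w (Suc n)"
    by (rule module_weighted_chains)
  show ?thesis
  proof (rule M.submoduleI')
    show "weighted_boundaries R K w n \<subseteq> carrier (weighted_chains R K w n)"
      unfolding weighted_boundaries_def using weighted_boundary_Suc_closed by blast
    show "\<zero>\<^bsub>weighted_chains R K w n\<^esub> \<in> weighted_boundaries R K w n"
      unfolding weighted_boundaries_def
      by (rule image_eqI[OF _ C.M.zero_closed]) (simp only: weighted_chains_simps weighted_boundary_zero)
  next
    fix x y assume "x \<in> weighted_boundaries R K w n" "y \<in> weighted_boundaries R K w n"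
    then obtain c d where "c \<in> carrier (weighted_chains R K w (Suc n))"
      "d \<in> carrier (weighted_chains R K w (Suc n))"
      "x = weighted_boundary R K w (Suc n) c" "y = weighted_boundary R K w (Suc n) d"
      unfolding weighted_boundaries_def by blast
    then show "x \<oplus>\<^bsub>weighted_chains R K w n\<^esub> y \<in> weighted_boundaries R K w n"
      unfolding weighted_boundaries_def
      by (intro image_eqI[OF _ C.M.a_closed[of c d]])
        (simp_all only: weighted_chains_simps weighted_boundary_add)
  next
    fix r x assume "r \<in> carrier R" "x \<in> weighted_boundaries R K w n"
    then obtain c where "r \<in> carrier R" "c \<in> carrier (weighted_chains R K w (Suc n))"
      "x = weighted_boundary R K w (Suc n) c"
      unfolding weighted_boundaries_def by blast
    then show "r \<odot>\<^bsub>weighted_chains R K w n\<^esub> x \<in> weighted_boundaries R K w n"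
      unfolding weighted_boundaries_def
      by (intro image_eqI[OF _ C.smult_closed[of r c]])
        (simp_all only: weighted_chains_simps weighted_boundary_smult)
  qed
qed

end


section \<open>Subcomplexes and collapses\<close>

locale weighted_subcomplex = weighted_simplicial_complex R K w +
  L: weighted_simplicial_complex R L w for R (structure) and K L :: "'v::linorder set set" and w +
  assumes subcomplex: "L \<subseteq> K"
begin

lemma weighted_basis_mono: "weighted_basis R L w n \<subseteq> weighted_basis R K w n"
  using subcomplex by (auto simp: weighted_basis_def)

lemma weighted_chains_mono:
  "carrier (weighted_chains R L w n) \<subseteq> carrier (weighted_chains R K w n)"
  using weighted_basis_mono unfolding L.carrier_weighted_chains carrier_weighted_chains subset_iff
  by blast

text \<open>Incidence numbers do not depend on the complex, and the additional summands for
  \<open>K\<close> vanish because \<open>c\<close> is zero outside the basis of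
  \<open>L\<close>.\<close>

lemma weighted_boundary_subcomplex:
  assumes "c \<in> carrier (weighted_chains R L w n)"
  shows "weighted_boundary R L w n c = weighted_boundary R K w n c"
proof (cases n)
  case (Suc k)
  have c: "c \<in> carrier (weighted_chains R L w (Suc k))" "c \<in> carrier (weighted_chains R K w (Suc k))"
    using assms weighted_chains_mono Suc by auto
  have "(\<Oplus>\<sigma>\<in>weighted_basis R L w (Suc k). c \<sigma> \<otimes> incidence R w \<sigma> \<rho>)
      = (\<Oplus>\<sigma>\<in>weighted_basis R K w (Suc k). c \<sigma> \<otimes> incidence R w \<sigma> \<rho>)" for \<rho>
    using weighted_boundary_summand_closed[OF c(2)] c(1) incidence_closed
    by (intro add.finprod_mono_neutral_cong_left finite_weighted_basis weighted_basis_mono)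
      (auto simp: L.carrier_weighted_chains)
  then show ?thesis
    unfolding Suc by (intro ext) (simp only: L.weighted_boundary_Suc_apply[OF c(1)]
        weighted_boundary_Suc_apply[OF c(2)])
qed simp

lemma weighted_cycles_mono: "weighted_cycles R L w n \<subseteq> weighted_cycles R K w n"
  using weighted_chains_mono weighted_boundary_subcomplex by (auto simp: weighted_cycles_def)

lemma weighted_boundaries_mono: "weighted_boundaries R L w n \<subseteq> weighted_boundaries R K w n"
  unfolding weighted_boundaries_def using weighted_chains_mono weighted_boundary_subcomplex
  by (metis image_cong image_mono)

text \<open>Both chain modules have the same pointwise operations. This places the cycles and
  boundaries of \<open>L\<close> in the chain module of \<open>K\<close>, which then serves as the
  common ambient module.\<close>

lemma submodule_weighted_chains_mono:
  assumes "submodule H R (weighted_chains R L w n)"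
  shows "submodule H R (weighted_chains R K w n)"
proof -
  interpret K: module R "weighted_chains R K w n"
    by (rule module_weighted_chains)
  interpret L: module R "weighted_chains R L w n"
    by (rule L.module_weighted_chains)
  have "\<zero>\<^bsub>weighted_chains R L w n\<^esub> \<in> H"
    using subgroup.one_closed[OF submodule.axioms(1)[OF assms]] by simp
  then show ?thesis
    using L.submoduleE[OF assms] subset_trans[OF _ weighted_chains_mono]
    by (intro K.submoduleI') (simp_all add: weighted_chains_simps L.weighted_chains_simps)
qed

lemma weighted_homology_isomorphicI:
  assumes "\<And>z. z \<in> weighted_cycles R K w n \<Longrightarrow>
      \<exists>b\<in>weighted_boundaries R K w n. (\<lambda>\<rho>. b \<rho> \<oplus> z \<rho>) \<in> weighted_cycles R L w n"
    and "weighted_cycles R L w n \<inter> weighted_boundaries R K w n \<subseteq> weighted_boundaries R L w n"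
  shows "module_isomorphic R (weighted_homology R K w n) (weighted_homology R L w n)"
proof -
  \<comment> \<open>The two chain modules differ only in their carriers, and these are overwritten
    here.\<close>
  have "(weighted_chains R L w n)\<lparr>carrier := H\<rparr> = (weighted_chains R K w n)\<lparr>carrier := H\<rparr>" for H
    by (simp add: weighted_chains_def free_module_def)
  then have L: "weighted_homology R L w n =
      quotient_module ((weighted_chains R K w n)\<lparr>carrier := weighted_cycles R L w n\<rparr>)
        (weighted_boundaries R L w n)"
    by (simp add: weighted_homology_def)
  show ?thesis
    unfolding L unfolding weighted_homology_def
    using assms
    by (intro quotient_module_isomorphicI module_weighted_chains
        submodule_weighted_cycles submodule_weighted_boundaries
        submodule_weighted_chains_mono[OF L.submodule_weighted_cycles]
        submodule_weighted_chains_mono[OF L.submodule_weighted_boundaries]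
        weighted_cycles_mono weighted_boundaries_mono) (simp_all add: weighted_chains_simps)
qed

end

section \<open>Collapsing along a free face\<close>

lemma weighted_complex_collapse:
  assumes "weighted_complex R K w" and "free_face K \<sigma> \<tau>"
  shows "weighted_complex R (K - {\<sigma>, \<tau>}) w"
proof -
  have K: "simplicial_complex K"
    using assms(1) by (simp add: weighted_complex_def)
  have "simplicial_complex (K - {\<sigma>, \<tau>})"
    unfolding simplicial_complex_def
  proof (intro conjI ballI allI impI)
    fix \<upsilon> \<rho> assume \<upsilon>: "\<upsilon> \<in> K - {\<sigma>, \<tau>}" and \<rho>: "\<rho> \<subseteq> \<upsilon> \<and> \<rho> \<noteq> {}"
    then have "\<rho> \<in> K"
      using K unfolding simplicial_complex_def by blast
    \<comment> \<open>If \<open>\<rho>\<close> were \<open>\<sigma>\<close> or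
      \<open>\<tau>\<close>, then \<open>\<upsilon>\<close> would properly contain
      \<open>\<sigma>\<close> and so be \<open>\<tau>\<close> by freeness.\<close>
    then show "\<rho> \<in> K - {\<sigma>, \<tau>}"
      using assms(2) \<upsilon> \<rho> unfolding free_face_def by blast
  qed (use K in \<open>auto simp: simplicial_complex_def\<close>)
  then show ?thesis
    using assms(1) by (auto simp: weighted_complex_def)
qed

theorem theorem3p10:
  fixes R :: "('r, 'm) ring_scheme"
    and K L :: "'v::linorder set set"
    and w :: "'v set \<Rightarrow> 'r"
    and \<sigma> \<tau> :: "'v set"
    and u :: 'r
    and n :: nat
  assumes "domain R"
    and "weighted_complex R K w"
    and "n \<ge> 1"
    and "sdim \<sigma> = n - 1" and "sdim \<tau> = n"
    and "elementary_collapse K \<sigma> \<tau> n L"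
    and "w \<sigma> \<in> carrier R - {\<zero>\<^bsub>R\<^esub>}"
    and "u \<in> Units R"
    and "w \<tau> = u \<otimes>\<^bsub>R\<^esub> w \<sigma>"
  shows "\<forall>i. module_isomorphic R (weighted_homology R K w i) (weighted_homology R L w i)"
proof
  fix i
  interpret "domain" R by fact
  have free: "free_face K \<sigma> \<tau>" and L: "L = K - {\<sigma>, \<tau>}"
    using assms(6) by (auto simp: elementary_collapse_def)
  interpret weighted_subcomplex R K L w
    using weighted_complex_collapse[OF assms(2) free] assms(2) L by unfold_locales auto
  \<comment> \<open>\<open>m\<close> is the dimension of \<open>\<sigma>\<close>, and
    \<open>\<tau>\<close> has dimension \<open>Suc m\<close>.\<close>
  obtain m where m: "n = Suc m"
    using \<open>n \<ge> 1\<close> by (cases n) auto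
  let ?d = "incidence R w \<tau>"
  have u: "u \<in> carrier R" "u \<noteq> \<zero>\<^bsub>R\<^esub>"
    using assms(8) zero_not_in_Units by auto
  have \<sigma>: "\<sigma> \<in> weighted_basis R K w m"
    using free assms(4,7) m by (simp add: weighted_basis_def free_face_def)
  have "w \<tau> \<noteq> \<zero>\<^bsub>R\<^esub>"
    using assms(7,9) u integral by fastforce
  then have \<tau>: "\<tau> \<in> weighted_basis R K w (Suc m)"
    using free assms(5) m by (simp add: weighted_basis_def free_face_def)
  have d: "?d \<in> carrier (weighted_chains R K w m)"
    using \<tau> by (rule incidence_in_chains)
  \<comment> \<open>A nonzero incidence number would make \<open>\<sigma>\<close> a proper face of
    \<open>\<upsilon>\<close>, contrary to freeness.\<close>
  have coface: "incidence R w \<upsilon> \<sigma> = \<zero>\<^bsub>R\<^esub>" if "\<upsilon> \<in> weighted_basis R K w (Suc m)" "\<upsilon> \<noteq> \<tau>" for \<upsilon>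
    using that free by (intro incidence_eq_zero) (auto simp: weighted_basis_def free_face_def)
  have unit: "?d \<sigma> \<in> Units R"
  proof -
    have "\<sigma> \<subset> \<tau>" "finite \<tau>" "card \<tau> = Suc (card \<sigma>)"
      using free \<sigma> \<tau> weighted_basis_card finite_simplex by (auto simp: free_face_def)
    then have "card (\<tau> - \<sigma>) = 1"
      using card_Diff_subset[of \<sigma> \<tau>] finite_subset[of \<sigma> \<tau>] by auto
    then obtain v where "\<tau> - \<sigma> = {v}"
      by (rule card_1_singletonE)
    then have v: "v \<in> \<tau>" "\<sigma> = \<tau> - {v}"
      using \<open>\<sigma> \<subset> \<tau>\<close> by auto
    have "quot R (w \<tau>) (w \<sigma>) = u"
      using assms(7,9) u by (intro quot_eqI) (auto simp: m_comm)
    then have "?d \<sigma> = u \<otimes>\<^bsub>R\<^esub> (\<ominus>\<^bsub>R\<^esub> \<one>\<^bsub>R\<^esub>) [^]\<^bsub>R\<^esub> card {x \<in> \<tau>. x < v}"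
      using incidence_facet[OF v(1), of R w] v(2) by simp
    moreover have "(\<ominus>\<^bsub>R\<^esub> \<one>\<^bsub>R\<^esub>) [^]\<^bsub>R\<^esub> k \<in> Units R" for k :: nat
      by (induction k) auto
    ultimately show ?thesis
      using assms(8) by simp
  qed
  have chains_L: "c \<in> carrier (weighted_chains R L w j) \<longleftrightarrow>
      c \<in> carrier (weighted_chains R K w j) \<and> c \<sigma> = \<zero>\<^bsub>R\<^esub> \<and> c \<tau> = \<zero>\<^bsub>R\<^esub>" for c j
  proof -
    have "weighted_basis R L w j = weighted_basis R K w j - {\<sigma>, \<tau>}"
      by (auto simp: L weighted_basis_def)
    then show ?thesis
      unfolding L.carrier_weighted_chains carrier_weighted_chains by auto
  qed
  \<comment> \<open>\<open>\<sigma>\<close> and \<open>\<tau>\<close> live in different degrees, so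
    in each degree at most one of the two vanishing conditions in \<open>chains_L\<close> has
    content.\<close>
  have zero_\<sigma>: "c \<sigma> = \<zero>\<^bsub>R\<^esub>" if "c \<in> carrier (weighted_chains R K w j)" "j \<noteq> m" for c j
    using that \<sigma> by (auto simp: carrier_weighted_chains weighted_basis_def)
  have zero_\<tau>: "c \<tau> = \<zero>\<^bsub>R\<^esub>" if "c \<in> carrier (weighted_chains R K w j)" "j \<noteq> Suc m" for c j
    using that \<tau> by (auto simp: carrier_weighted_chains weighted_basis_def)
  have boundary_\<sigma>: "weighted_boundary R K w (Suc m) c \<sigma> = c \<tau> \<otimes>\<^bsub>R\<^esub> ?d \<sigma>"
    if c: "c \<in> carrier (weighted_chains R K w (Suc m))" for c
  proof -
    have "(\<Oplus>\<^bsub>R\<^esub>\<upsilon>\<in>weighted_basis R K w (Suc m). c \<upsilon> \<otimes>\<^bsub>R\<^esub> incidence R w \<upsilon> \<sigma>)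
        = (\<Oplus>\<^bsub>R\<^esub>\<upsilon>\<in>weighted_basis R K w (Suc m).
            if \<tau> = \<upsilon> then c \<upsilon> \<otimes>\<^bsub>R\<^esub> incidence R w \<upsilon> \<sigma> else \<zero>\<^bsub>R\<^esub>)"
      using c incidence_closed by (intro finsum_cong') (auto simp: coface carrier_weighted_chains)
    also have "\<dots> = c \<tau> \<otimes>\<^bsub>R\<^esub> ?d \<sigma>"
      by (intro finsum_singleton \<tau> finite_weighted_basis weighted_boundary_summand_closed c)
    finally show ?thesis
      by (simp only: weighted_boundary_Suc_apply[OF c])
  qed
  \<comment> \<open>This serves two purposes: it applies to cycles of degree \<open>Suc m\<close>,
    and to chains of that degree whose boundary is a chain of \<open>L\<close>.\<close>
  have vanish_\<tau>: "c \<tau> = \<zero>\<^bsub>R\<^esub>"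
    if "c \<in> carrier (weighted_chains R K w (Suc m))"
      and "weighted_boundary R K w (Suc m) c \<sigma> = \<zero>\<^bsub>R\<^esub>" for c
  proof -
    have "c \<tau> \<in> carrier R" "?d \<sigma> \<in> carrier R" "?d \<sigma> \<noteq> \<zero>\<^bsub>R\<^esub>"
      using that(1) unit zero_not_in_Units by (auto simp: carrier_weighted_chains)
    then show ?thesis
      using that boundary_\<sigma> integral by metis
  qed
  \<comment> \<open>For a cycle of degree \<open>m\<close>, this gives a homologous cycle in
    \<open>L\<close>. For an arbitrary chain of degree \<open>m\<close>, it gives a chain of
    \<open>L\<close> with the same boundary.\<close>
  have reduce: "\<exists>b\<in>weighted_boundaries R K w m. (\<lambda>\<rho>. b \<rho> \<oplus>\<^bsub>R\<^esub> c \<rho>) \<in> carrier (weighted_chains R L w m)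
      \<and> weighted_boundary R L w m (\<lambda>\<rho>. b \<rho> \<oplus>\<^bsub>R\<^esub> c \<rho>) = weighted_boundary R K w m c"
    if c: "c \<in> carrier (weighted_chains R K w m)" for c
  proof -
    interpret M: module R "weighted_chains R K w m"
      by (rule module_weighted_chains)
    \<comment> \<open>The multiple of the boundary of \<open>\<tau>\<close> whose entry at
      \<open>\<sigma>\<close> is the negative of \<open>c \<sigma>\<close>; it exists because
      \<open>?d \<sigma>\<close> is a unit.\<close>
    define t where "t = \<ominus>\<^bsub>R\<^esub> (c \<sigma>) \<otimes>\<^bsub>R\<^esub> inv\<^bsub>R\<^esub> (?d \<sigma>)"
    have c\<sigma>: "c \<sigma> \<in> carrier R"
      using c by (simp add: carrier_weighted_chains)
    then have t: "t \<in> carrier R"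
      using unit by (simp add: t_def)
    let ?b = "\<lambda>\<rho>. t \<otimes>\<^bsub>R\<^esub> ?d \<rho>"
    have b: "?b \<in> carrier (weighted_chains R K w m)"
      using M.smult_closed[OF t d] by (simp add: weighted_chains_simps)
    have b': "?b \<in> weighted_boundaries R K w m"
      using M.submoduleE(4)[OF submodule_weighted_boundaries t incidence_in_boundaries[OF \<tau>]]
      by (simp add: weighted_chains_simps)
    have "weighted_boundary R K w m ?b = (\<lambda>_. \<zero>\<^bsub>R\<^esub>)"
      using weighted_boundary_smult[OF t d] weighted_boundary_incidence[OF \<tau>] t by simp
    moreover have "weighted_boundary R K w m c \<rho> \<in> carrier R" for \<rho>
      using weighted_boundary_Suc_closed c by (cases m) (auto simp: carrier_weighted_chains)
    ultimately have "weighted_boundary R K w m (\<lambda>\<rho>. ?b \<rho> \<oplus>\<^bsub>R\<^esub> c \<rho>) = weighted_boundary R K w m c"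
      using weighted_boundary_add[OF b c] by simp
    moreover have "(\<lambda>\<rho>. ?b \<rho> \<oplus>\<^bsub>R\<^esub> c \<rho>) \<in> carrier (weighted_chains R L w m)"
    proof -
      have bc: "(\<lambda>\<rho>. ?b \<rho> \<oplus>\<^bsub>R\<^esub> c \<rho>) \<in> carrier (weighted_chains R K w m)"
        using M.M.a_closed[OF b c] by (simp add: weighted_chains_simps)
      moreover have "?b \<sigma> = \<ominus>\<^bsub>R\<^esub> (c \<sigma>)"
        using unit Units_closed[OF unit] c\<sigma> by (simp add: t_def m_assoc)
      \<comment> \<open>The entries at \<open>\<sigma>\<close> cancel, and the entry at
        \<open>\<tau>\<close> is zero because the chain has degree \<open>m\<close>.\<close>
      ultimately show ?thesis
        using c\<sigma> zero_\<tau>[OF bc] by (simp add: chains_L l_neg)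
    qed
    ultimately show ?thesis
      using b' weighted_boundary_subcomplex by (intro bexI[of _ ?b]) auto
  qed
  show "module_isomorphic R (weighted_homology R K w i) (weighted_homology R L w i)"
  proof (rule weighted_homology_isomorphicI)
    fix z assume "z \<in> weighted_cycles R K w i"
    then have z: "z \<in> carrier (weighted_chains R K w i)" "weighted_boundary R K w i z = (\<lambda>_. \<zero>\<^bsub>R\<^esub>)"
      by (auto simp: weighted_cycles_def)
    show "\<exists>b\<in>weighted_boundaries R K w i. (\<lambda>\<rho>. b \<rho> \<oplus>\<^bsub>R\<^esub> z \<rho>) \<in> weighted_cycles R L w i"
    proof (cases "i = m")
      case True
      then show ?thesis
        using reduce z by (fastforce simp: weighted_cycles_def)
    next
      case False
      \<comment> \<open>Outside degree \<open>m\<close> the cycle already lies in \<open>L\<close>,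
        so the zero boundary serves as \<open>b\<close>.\<close>
      have "z \<tau> = \<zero>\<^bsub>R\<^esub>"
        using vanish_\<tau> zero_\<tau> z by (cases "i = Suc m") auto
      then have "z \<in> carrier (weighted_chains R L w i)"
        using z zero_\<sigma> False by (simp add: chains_L)
      then have "z \<in> weighted_cycles R L w i"
        using z weighted_boundary_subcomplex by (simp add: weighted_cycles_def)
      moreover have "(\<lambda>\<rho>. \<zero>\<^bsub>R\<^esub> \<oplus>\<^bsub>R\<^esub> z \<rho>) = z"
        using z by (auto simp: carrier_weighted_chains)
      moreover have "(\<lambda>_. \<zero>\<^bsub>R\<^esub>) \<in> weighted_boundaries R K w i"
        using subgroup.one_closed[OF submodule.axioms(1)[OF submodule_weighted_boundaries]]
        by (simp add: weighted_chains_simps)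
      ultimately show ?thesis
        by (intro bexI[of _ "\<lambda>_. \<zero>\<^bsub>R\<^esub>"]) simp_all
    qed
  next
    show "weighted_cycles R L w i \<inter> weighted_boundaries R K w i \<subseteq> weighted_boundaries R L w i"
    proof
      fix x assume "x \<in> weighted_cycles R L w i \<inter> weighted_boundaries R K w i"
      \<comment> \<open>As a chain of \<open>L\<close>, \<open>x\<close> vanishes at
        \<open>\<sigma>\<close>; for \<open>i = m\<close> this is what \<open>vanish_\<tau>\<close>
        requires.\<close>
      then obtain c where c: "c \<in> carrier (weighted_chains R K w (Suc i))"
        and x: "x = weighted_boundary R K w (Suc i) c" "x \<sigma> = \<zero>\<^bsub>R\<^esub>"
        unfolding weighted_cycles_def weighted_boundaries_def chains_L by blast
      \<comment> \<open>If \<open>Suc i = m\<close>, the chain \<open>c\<close> may contain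
        \<open>\<sigma>\<close> and is corrected by \<open>reduce\<close>; in all other degrees
        \<open>c\<close> itself lies in \<open>L\<close>.\<close>
      have "\<exists>c'\<in>carrier (weighted_chains R L w (Suc i)). x = weighted_boundary R L w (Suc i) c'"
      proof (cases "Suc i = m")
        case True
        then show ?thesis
          using reduce c x by metis
      next
        case False
        have "c \<tau> = \<zero>\<^bsub>R\<^esub>"
          using vanish_\<tau> zero_\<tau> c x by (cases "i = m") auto
        then have "c \<in> carrier (weighted_chains R L w (Suc i))"
          using c zero_\<sigma> False by (simp add: chains_L)
        then show ?thesis
          using x weighted_boundary_subcomplex by metis
      qed
      then show "x \<in> weighted_boundaries R L w i"
        unfolding weighted_boundaries_def by blast
    qed
  qed
qed

end
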